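(* Let $R$ be $\mathbb{R}$ or $\mathbb{C}$, and let $X$ and $Y$ be arbitrary convergence spaces. For a convergence space $Z$, let $[Z,R]$ denote the set of continuous functions $Z \to R$, endowed with the continuous-convergence structure (the exponential/function space in the cartesian closed category $\mathbf{Conv}$ of convergence spaces) and with the pointwise $R$-vector-space structure, so that $[Z,R]$ is a convergence vector space. Given continuous linear functionals $\mu:[X,R]\to R$ and $\nu:[Y,R]\to R$, there is a unique continuous linear functional $\mu\otimes\nu:[X\times Y,R]\to R$ such that $$\nu\big(\lambda y.\,\mu(\lambda x.\,f(x,y))\big) \;=\; (\mu\otimes\nu)(f) \;=\; \mu\big(\lambda x.\,\nu(\lambda y.\,f(x,y))\big)$$ for all continuous functions $f:X\times Y\to R$; in particular, the functions $y\mapsto \mu(\lambda x.f(x,y))$ on $Y$ and $x\mapsto\nu(\lambda y.f(x,y))$ on $X$ are continuous. (In integral notation, writing $\int f\,d\mu$ for $\mu(f)$: $\int_y\int_x f(x,y)\,d\mu\,d\nu = \int f\,d(\mu\otimes\nu) = \int_x\int_y f(x,y)\,d\nu\,d\mu$.)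
   Context: A convergence space is a set equipped with a convergence structure (a relation between filters and points satisfying the usual axioms); continuous maps are those preserving convergence of filters. The category $\mathbf{Conv}$ of convergence spaces and continuous maps is cartesian closed, $X\times Y$ denotes the product in $\mathbf{Conv}$, and function spaces carry the continuous-convergence structure. A convergence vector space is an $R$-vector space with a convergence structure making addition and scalar multiplication continuous. The notation $\lambda x.\,g(x)$ denotes the function $x\mapsto g(x)$. *)

theory Defs
  imports "HOL-Analysis.Analysis"
begin

text \<open>A convergence structure on the type 'a is a relation between filters and points.
  Isabelle's filter order is reversed w.r.t. set inclusion: G \<le> F means G is finer than F.
  The improper filter bot is allowed; it converges to every point (forced by isotony),
  which is harmless.\<close>

definition conv_space :: "('a filter \<Rightarrow> 'a \<Rightarrow> bool) \<Rightarrow> bool" where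
  "conv_space c \<longleftrightarrow>
     (\<forall>x. c (principal {x}) x) \<and> (\<forall>F G x. c F x \<longrightarrow> G \<le> F \<longrightarrow> c G x)"

definition conv_cont ::
  "('a filter \<Rightarrow> 'a \<Rightarrow> bool) \<Rightarrow> ('b filter \<Rightarrow> 'b \<Rightarrow> bool) \<Rightarrow> ('a \<Rightarrow> 'b) \<Rightarrow> bool" where
  "conv_cont cA cB f \<longleftrightarrow> (\<forall>F x. cA F x \<longrightarrow> cB (filtermap f F) (f x))"

definition top_conv :: "'a::topological_space filter \<Rightarrow> 'a \<Rightarrow> bool" where
  "top_conv F x \<longleftrightarrow> F \<le> nhds x"

definition prod_conv ::
  "('a filter \<Rightarrow> 'a \<Rightarrow> bool) \<Rightarrow> ('b filter \<Rightarrow> 'b \<Rightarrow> bool) \<Rightarrow> ('a \<times> 'b) filter \<Rightarrow> 'a \<times> 'b \<Rightarrow> bool" where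
  "prod_conv cA cB H p \<longleftrightarrow> cA (filtermap fst H) (fst p) \<and> cB (filtermap snd H) (snd p)"

definition cfuns :: "('z filter \<Rightarrow> 'z \<Rightarrow> bool) \<Rightarrow> ('z \<Rightarrow> 'r::topological_space) set" where
  "cfuns cZ = {f. conv_cont cZ top_conv f}"

text \<open>Continuous convergence on [Z,R]; filters on the carrier are represented as filters on
  the function type that eventually lie in the carrier.\<close>
definition fun_conv ::
  "('z filter \<Rightarrow> 'z \<Rightarrow> bool) \<Rightarrow> ('z \<Rightarrow> 'r::topological_space) filter \<Rightarrow> ('z \<Rightarrow> 'r) \<Rightarrow> bool" where
  "fun_conv cZ \<Phi> f \<longleftrightarrow>
     eventually (\<lambda>g. g \<in> cfuns cZ) \<Phi> \<and> f \<in> cfuns cZ \<and>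
     (\<forall>F z. cZ F z \<longrightarrow> top_conv (filtermap (\<lambda>(g, w). g w) (\<Phi> \<times>\<^sub>F F)) (f z))"

text \<open>Continuous linear functional [Z,R] \<rightarrow> R (only its values on the carrier matter).\<close>
definition cont_lin_functional ::
  "('z filter \<Rightarrow> 'z \<Rightarrow> bool) \<Rightarrow> (('z \<Rightarrow> 'r::real_normed_field) \<Rightarrow> 'r) \<Rightarrow> bool" where
  "cont_lin_functional cZ \<mu> \<longleftrightarrow>
     (\<forall>f\<in>cfuns cZ. \<forall>g\<in>cfuns cZ. \<mu> (\<lambda>z. f z + g z) = \<mu> f + \<mu> g) \<and>
     (\<forall>c. \<forall>f\<in>cfuns cZ. \<mu> (\<lambda>z. c * f z) = c * \<mu> f) \<and>
     (\<forall>\<Phi> f. fun_conv cZ \<Phi> f \<longrightarrow> top_conv (filtermap \<mu> \<Phi>) (\<mu> f))"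

end

theory Submission
  imports Defs "HOL-Real_Asymp.Real_Asymp"
begin

text \<open>Currying makes both iterated functionals continuous and linear, and they agree on tensors
  \<open>g(x) h(y)\<close>; the point is to approximate \<open>f\<close> by sums of tensors. A continuous functional
  \<open>\<mu>\<close> has a support \<open>K\<close>, the zero set of the ideal \<open>{h. \<mu> (h k) = 0 for all k}\<close>. Two Dini-type
  arguments show that \<open>norm (\<mu> g)\<close> is at most a constant times the supremum of \<open>norm g\<close> over \<open>K\<close>,
  and that continuous convergence implies uniform convergence on \<open>K\<close>. If \<open>L\<close> is the support of
  \<open>\<nu>\<close>, then \<open>f\<close> can be approximated uniformly on \<open>K \<times> L\<close> by sums of tensors.\<close>

section \<open>Algebra of continuous functions\<close>

lemma cfuns_iff: "f \<in> cfuns c \<longleftrightarrow> (\<forall>F z. c F z \<longrightarrow> (f \<longlongrightarrow> f z) F)"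
  by (simp add: cfuns_def conv_cont_def top_conv_def filterlim_def)

lemma fun_conv_iff:
  "fun_conv c \<Phi> f \<longleftrightarrow> eventually (\<lambda>g. g \<in> cfuns c) \<Phi> \<and> f \<in> cfuns c \<and>
     (\<forall>F z. c F z \<longrightarrow> ((\<lambda>(g, w). g w) \<longlongrightarrow> f z) (\<Phi> \<times>\<^sub>F F))"
  by (simp add: fun_conv_def top_conv_def filterlim_def)

lemma cfuns_const [simp]: "(\<lambda>z. a) \<in> cfuns c"
  by (simp add: cfuns_iff)

lemma cfuns_compose:
  fixes f :: "'z \<Rightarrow> 'r::real_normed_vector"
  assumes "f \<in> cfuns c" "continuous_on UNIV \<phi>"
  shows "(\<lambda>z. \<phi> (f z)) \<in> cfuns c"
  unfolding cfuns_iff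
proof (intro allI impI)
  fix F z assume "c F z"
  then have "(f \<longlongrightarrow> f z) F" using assms(1) by (simp add: cfuns_iff)
  moreover have "isCont \<phi> (f z)"
    using assms(2) by (simp add: continuous_on_eq_continuous_at)
  ultimately show "((\<lambda>z. \<phi> (f z)) \<longlongrightarrow> \<phi> (f z)) F"
    by (rule isCont_tendsto_compose[rotated])
qed

lemma cfuns_add:
  fixes f g :: "'z \<Rightarrow> 'r::real_normed_vector"
  assumes "f \<in> cfuns c" "g \<in> cfuns c"
  shows "(\<lambda>z. f z + g z) \<in> cfuns c"
  using assms by (auto simp: cfuns_iff intro!: tendsto_add)

lemma cfuns_diff:
  fixes f g :: "'z \<Rightarrow> 'r::real_normed_vector"
  assumes "f \<in> cfuns c" "g \<in> cfuns c"
  shows "(\<lambda>z. f z - g z) \<in> cfuns c"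
  using assms by (auto simp: cfuns_iff intro!: tendsto_diff)

lemma cfuns_mult:
  fixes f g :: "'z \<Rightarrow> 'r::real_normed_algebra"
  assumes "f \<in> cfuns c" "g \<in> cfuns c"
  shows "(\<lambda>z. f z * g z) \<in> cfuns c"
  using assms by (auto simp: cfuns_iff intro!: tendsto_mult)

lemma cfuns_divide:
  fixes f g :: "'z \<Rightarrow> 'r::real_normed_field"
  assumes "f \<in> cfuns c" "g \<in> cfuns c" "\<And>z. g z \<noteq> 0"
  shows "(\<lambda>z. f z / g z) \<in> cfuns c"
  using assms by (auto simp: cfuns_iff intro!: tendsto_divide)

lemma cfuns_max:
  fixes f g :: "'z \<Rightarrow> real"
  assumes "f \<in> cfuns c" "g \<in> cfuns c"
  shows "(\<lambda>z. max (f z) (g z)) \<in> cfuns c"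
  using assms by (auto simp: cfuns_iff intro!: tendsto_max)

lemma cfuns_min:
  fixes f g :: "'z \<Rightarrow> real"
  assumes "f \<in> cfuns c" "g \<in> cfuns c"
  shows "(\<lambda>z. min (f z) (g z)) \<in> cfuns c"
  using assms by (auto simp: cfuns_iff intro!: tendsto_min)

lemma cfuns_sum:
  fixes f :: "'i \<Rightarrow> 'z \<Rightarrow> 'r::real_normed_vector"
  assumes "\<And>i. i \<in> S \<Longrightarrow> f i \<in> cfuns c"
  shows "(\<lambda>z. \<Sum>i\<in>S. f i z) \<in> cfuns c"
  using assms by (auto simp: cfuns_iff intro!: tendsto_sum)

lemma cfuns_prod:
  fixes f :: "'i \<Rightarrow> 'z \<Rightarrow> 'r::{real_normed_algebra,comm_ring_1}"
  assumes "\<And>i. i \<in> S \<Longrightarrow> f i \<in> cfuns c"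
  shows "(\<lambda>z. \<Prod>i\<in>S. f i z) \<in> cfuns c"
  using assms by (induction S rule: infinite_finite_induct) (auto intro!: cfuns_mult)

lemma cfuns_norm:
  fixes f :: "'z \<Rightarrow> 'r::real_normed_vector"
  shows "f \<in> cfuns c \<Longrightarrow> (\<lambda>z. norm (f z)) \<in> cfuns c"
  by (auto simp: cfuns_iff intro!: tendsto_norm)

lemma cfuns_of_real:
  "f \<in> cfuns c \<Longrightarrow> (\<lambda>z. of_real (f z) :: 'r::real_normed_algebra_1) \<in> cfuns c"
  by (auto simp: cfuns_iff intro!: tendsto_of_real)

lemmas cfuns_intros =
  cfuns_const cfuns_add cfuns_diff cfuns_mult cfuns_max cfuns_min cfuns_sum cfuns_prod
  cfuns_norm cfuns_of_real

section \<open>Criteria for continuous convergence to zero\<close>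

text \<open>Pushing \<open>I\<close> forward along \<open>G\<close> allows families indexed by
  naturals, finite sets or functions; the joint limit is then tested on pairs
  \<open>(i, w)\<close>.\<close>

lemma fun_conv_zeroI:
  fixes G :: "'i \<Rightarrow> 'z \<Rightarrow> 'r::real_normed_vector"
  assumes "eventually (\<lambda>i. G i \<in> cfuns c) I"
    and "\<And>F z e. c F z \<Longrightarrow> e > 0 \<Longrightarrow> eventually (\<lambda>(i, w). norm (G i w) < e) (I \<times>\<^sub>F F)"
  shows "fun_conv c (filtermap G I) (\<lambda>_. 0)"
  unfolding fun_conv_iff
proof (intro conjI allI impI)
  fix F z assume c: "c F z"
  show "((\<lambda>(g, w). g w) \<longlongrightarrow> 0) (filtermap G I \<times>\<^sub>F F)"
    unfolding tendsto_iff prod_filtermap1 eventually_filtermap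
    using assms(2)[OF c] by (simp add: case_prod_unfold)
qed (use assms(1) in \<open>auto simp: eventually_filtermap\<close>)

text \<open>A form of Dini's theorem: domination by functions that are small at the limit point
  already gives continuous convergence, as each dominating function is itself continuous.\<close>

lemma fun_conv_zero_dominated:
  fixes G :: "'i \<Rightarrow> 'z \<Rightarrow> 'r::real_normed_vector" and I :: "'i filter"
  assumes ev: "eventually (\<lambda>i. G i \<in> cfuns c) I"
    and dom: "\<And>z e. e > 0 \<Longrightarrow>
      \<exists>d :: 'z \<Rightarrow> real. d \<in> cfuns c \<and> d z < e \<and> eventually (\<lambda>i. \<forall>w. norm (G i w) \<le> d w) I"
  shows "fun_conv c (filtermap G I) (\<lambda>_. 0)"
proof (rule fun_conv_zeroI[OF ev])
  fix F z and e :: real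
  assume c: "c F z" and "e > 0"
  from dom[OF this(2), of z] obtain d :: "'z \<Rightarrow> real" where
    d: "d \<in> cfuns c" "d z < e" "eventually (\<lambda>i. \<forall>w. norm (G i w) \<le> d w) I" by blast
  have "eventually (\<lambda>w. d w < e) F"
    using d(1,2) c by (auto simp: cfuns_iff intro: order_tendstoD)
  with d(3) show "eventually (\<lambda>(i, w). norm (G i w) < e) (I \<times>\<^sub>F F)"
    unfolding eventually_prod_filter
    by (intro exI[of _ "\<lambda>i. \<forall>w. norm (G i w) \<le> d w"] exI[of _ "\<lambda>w. d w < e"])
      (auto intro: le_less_trans)
qed

text \<open>Serves to reduce a general limit to the limit 0, for which uniform convergence on the
  support is stated. The continuity of \<open>f\<close> itself supplies the limit of the subtracted
  term.\<close>

lemma fun_conv_diff: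
  fixes f :: "'z \<Rightarrow> 'r::real_normed_vector"
  assumes "fun_conv c \<Phi> f"
  shows "fun_conv c (filtermap (\<lambda>g z. g z - f z) \<Phi>) (\<lambda>_. 0)"
proof (rule fun_conv_zeroI)
  show "eventually (\<lambda>g. (\<lambda>z. g z - f z) \<in> cfuns c) \<Phi>"
    using assms unfolding fun_conv_iff by (auto elim!: eventually_mono intro!: cfuns_diff)
next
  fix F z and e :: real
  assume c: "c F z" and e: "e > 0"
  have 1: "((\<lambda>(g, w). g w) \<longlongrightarrow> f z) (\<Phi> \<times>\<^sub>F F)" and f: "(f \<longlongrightarrow> f z) F"
    using assms c by (auto simp: fun_conv_iff cfuns_iff)
  have "((\<lambda>p. f (snd p)) \<longlongrightarrow> f z) (\<Phi> \<times>\<^sub>F F)"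
    by (rule filterlim_compose[OF f filterlim_snd])
  from tendsto_diff[OF 1 this]
  have "((\<lambda>(g, w). g w - f w) \<longlongrightarrow> 0) (\<Phi> \<times>\<^sub>F F)" by (simp add: case_prod_unfold)
  then show "eventually (\<lambda>(g, w). norm (g w - f w) < e) (\<Phi> \<times>\<^sub>F F)"
    using e by (simp add: tendsto_iff case_prod_unfold)
qed

section \<open>Linearity of a continuous functional\<close>

context
  fixes c :: "'z filter \<Rightarrow> 'z \<Rightarrow> bool" and \<mu> :: "('z \<Rightarrow> 'r::real_normed_field) \<Rightarrow> 'r"
  assumes \<mu>: "cont_lin_functional c \<mu>"
begin

lemma functional_add:
  "f \<in> cfuns c \<Longrightarrow> g \<in> cfuns c \<Longrightarrow> \<mu> (\<lambda>z. f z + g z) = \<mu> f + \<mu> g"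
  using \<mu> by (auto simp: cont_lin_functional_def)

lemma functional_scale: "f \<in> cfuns c \<Longrightarrow> \<mu> (\<lambda>z. a * f z) = a * \<mu> f"
  using \<mu> by (auto simp: cont_lin_functional_def)

lemma functional_scale_right: "f \<in> cfuns c \<Longrightarrow> \<mu> (\<lambda>z. f z * a) = \<mu> f * a"
  using functional_scale[of f a] by (simp add: mult.commute)

lemma functional_tendsto: "fun_conv c \<Phi> f \<Longrightarrow> (\<mu> \<longlongrightarrow> \<mu> f) \<Phi>"
  using \<mu> by (auto simp: cont_lin_functional_def top_conv_def filterlim_def)

lemma functional_zero: "\<mu> (\<lambda>z. 0) = 0"
  using functional_scale[of "\<lambda>_. 0" 0] by simp

lemma functional_diff:
  assumes "f \<in> cfuns c" "g \<in> cfuns c"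
  shows "\<mu> (\<lambda>z. f z - g z) = \<mu> f - \<mu> g"
  using functional_add[OF cfuns_diff[OF assms] assms(2)] by simp

lemma functional_sum:
  assumes "\<And>i. i \<in> S \<Longrightarrow> f i \<in> cfuns c"
  shows "\<mu> (\<lambda>z. \<Sum>i\<in>S. f i z) = (\<Sum>i\<in>S. \<mu> (f i))"
  using assms
  by (induction S rule: infinite_finite_induct)
     (auto simp: functional_zero functional_add cfuns_sum)

lemma functional_tendsto_zero:
  "fun_conv c (filtermap G I) (\<lambda>_. 0) \<Longrightarrow> ((\<lambda>i. \<mu> (G i)) \<longlongrightarrow> 0) I"
  using functional_tendsto[of "filtermap G I" "\<lambda>_. 0"]
  by (simp add: functional_zero filterlim_filtermap)

section \<open>The null ideal and the support\<close>

text \<open>The largest ideal of continuous functions inside the kernel of \<open>\<mu>\<close>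
  (take \<open>k = 1\<close> for the inclusion). It lets the support be defined by functions alone,
  without open sets.\<close>

definition null_ideal :: "('z \<Rightarrow> 'r) set" where
  "null_ideal = {h \<in> cfuns c. \<forall>k\<in>cfuns c. \<mu> (\<lambda>z. h z * k z) = 0}"

definition supp :: "'z set" where
  "supp = {x. \<forall>h\<in>null_ideal. h x = 0}"

lemma null_ideal_cfuns: "h \<in> null_ideal \<Longrightarrow> h \<in> cfuns c"
  by (simp add: null_ideal_def)

lemma null_idealD: "h \<in> null_ideal \<Longrightarrow> k \<in> cfuns c \<Longrightarrow> \<mu> (\<lambda>z. h z * k z) = 0"
  by (simp add: null_ideal_def)

lemma null_ideal_mult:
  assumes "h \<in> null_ideal" "k \<in> cfuns c"
  shows "(\<lambda>z. h z * k z) \<in> null_ideal"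
  using assms by (auto simp: null_ideal_def mult.assoc intro: cfuns_mult)

lemma null_ideal_sum:
  assumes "\<And>i. i \<in> S \<Longrightarrow> h i \<in> null_ideal"
  shows "(\<lambda>z. \<Sum>i\<in>S. h i z) \<in> null_ideal"
proof -
  have "\<mu> (\<lambda>z. (\<Sum>i\<in>S. h i z) * k z) = 0" if "k \<in> cfuns c" for k
    using that assms
    by (simp add: sum_distrib_right functional_sum cfuns_mult null_ideal_cfuns null_idealD)
  then show ?thesis using assms by (auto simp: null_ideal_def intro: cfuns_sum)
qed

text \<open>Multiply \<open>h\<close> by its conjugate. The squares are nonnegative, so they add up
  without cancellation and can serve in a denominator \<open>1 + u\<close>.\<close>

lemma null_ideal_norm_square:
  assumes h: "h \<in> null_ideal"
  shows "(\<lambda>z. of_real ((norm (h z))\<^sup>2)) \<in> null_ideal"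
proof -
  \<comment> \<open>This \<open>\<phi>\<close> is complex conjugation, written so that it makes sense for either field.\<close>
  define \<phi> :: "'r \<Rightarrow> 'r" where "\<phi> w = of_real ((norm w)\<^sup>2) / w" for w
  have "isCont \<phi> w" for w
  proof (cases "w = 0")
    case False
    then show ?thesis unfolding \<phi>_def by (auto intro!: continuous_intros)
  next
    \<comment> \<open>Division by zero gives \<open>\<phi> 0 = 0\<close>, and \<open>\<phi>\<close>
      preserves norms, so continuity at 0 follows.\<close>
    case True
    have n: "norm (\<phi> w) = norm w" for w
      by (cases "w = 0") (auto simp: \<phi>_def norm_divide power2_eq_square norm_mult)
    have "((\<lambda>w. norm (\<phi> w)) \<longlongrightarrow> 0) (at 0)" by (simp add: n tendsto_norm_zero)
    then have "(\<phi> \<longlongrightarrow> 0) (at 0)" by (rule tendsto_norm_zero_cancel)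
    with True show ?thesis by (simp add: isCont_def \<phi>_def)
  qed
  then have "(\<lambda>z. \<phi> (h z)) \<in> cfuns c"
    by (intro cfuns_compose[OF null_ideal_cfuns[OF h]]) (simp add: continuous_on_eq_continuous_at)
  from null_ideal_mult[OF h this] have "(\<lambda>z. h z * \<phi> (h z)) \<in> null_ideal" .
  moreover have "w * \<phi> w = of_real ((norm w)\<^sup>2)" for w by (simp add: \<phi>_def)
  ultimately show ?thesis by simp
qed

text \<open>Modulo the null ideal, \<open>g\<close> equals \<open>g / (1 + u)\<close> for every \<open>u \<ge> 0\<close> in the ideal, and
  these quotients decrease to 0 pointwise when \<open>g\<close> vanishes on the support.\<close>

lemma functional_eq_zero:
  assumes g: "g \<in> cfuns c" and z: "\<And>x. x \<in> supp \<Longrightarrow> g x = 0"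
  shows "\<mu> g = 0"
proof -
  define u :: "('z \<Rightarrow> 'r) set \<Rightarrow> 'z \<Rightarrow> real" where "u T x = (\<Sum>h\<in>T. (norm (h x))\<^sup>2)" for T x
  define G where "G T x = g x / of_real (1 + u T x)" for T x
  let ?I = "finite_subsets_at_top null_ideal"
  have u0: "u T x \<ge> 0" for T x by (simp add: u_def sum_nonneg)
  have nz: "of_real (1 + u T x) \<noteq> (0::'r)" for T x
    using u0[of T x] by (metis add_nonneg_eq_0_iff of_real_eq_0_iff zero_le_one zero_neq_one)
  have uc: "u T \<in> cfuns c" if "T \<subseteq> null_ideal" for T
    unfolding u_def power2_eq_square using that by (intro cfuns_intros null_ideal_cfuns) auto
  have Gc: "G T \<in> cfuns c" if "T \<subseteq> null_ideal" for T
    unfolding G_def using that nz by (intro cfuns_divide cfuns_intros g uc)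
  have evT: "eventually (\<lambda>T. T \<subseteq> null_ideal \<and> finite T) ?I"
    by (auto simp: eventually_finite_subsets_at_top)
  have "fun_conv c (filtermap G ?I) (\<lambda>_. 0)"
  proof (rule fun_conv_zero_dominated)
    show "eventually (\<lambda>T. G T \<in> cfuns c) ?I"
      using evT by eventually_elim (auto intro: Gc)
  next
    fix z and e :: real
    assume e: "e > 0"
    \<comment> \<open>One element of the ideal makes the bound small at \<open>z\<close>: on the
      support \<open>g z = 0\<close> and \<open>h = 0\<close> will do; off it some \<open>h\<close>
      is nonzero at \<open>z\<close> and may be rescaled.\<close>
    have "\<exists>h\<in>null_ideal. norm (g z) / (1 + (norm (h z))\<^sup>2) < e"
    proof (cases "z \<in> supp")
      case True
      have "(\<lambda>_. 0) \<in> null_ideal" by (simp add: null_ideal_def functional_zero)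
      then show ?thesis using z[OF True] e by force
    next
      case False
      then obtain h where h: "h \<in> null_ideal" "h z \<noteq> 0" by (auto simp: supp_def)
      \<comment> \<open>Chosen so that \<open>a * e = e + norm (g z)\<close> exceeds
        \<open>norm (g z)\<close>, while \<open>a \<ge> 1\<close> gives
        \<open>a \<le> 1 + a\<^sup>2\<close>.\<close>
      define a where "a = 1 + norm (g z) / e"
      have a: "a \<ge> 1" using e by (simp add: a_def)
      let ?h = "\<lambda>x. h x * (of_real a / h z)"
      have "?h \<in> null_ideal" by (intro null_ideal_mult h cfuns_const)
      moreover have "norm (?h z) = a" using h(2) a by simp
      moreover have "norm (g z) / (1 + a\<^sup>2) < e"
      proof -
        have "norm (g z) < a * e" using e by (simp add: a_def field_simps)
        also have "\<dots> \<le> (1 + a\<^sup>2) * e"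
          using a e by (intro mult_right_mono) (simp_all add: power2_eq_square add_increasing mult_le_cancel_left1)
        finally show ?thesis by (simp add: divide_less_eq mult.commute add_pos_nonneg)
      qed
      ultimately show ?thesis by metis
    qed
    then obtain h where h: "h \<in> null_ideal" "norm (g z) / (1 + (norm (h z))\<^sup>2) < e" by blast
    \<comment> \<open>Once \<open>h\<close> belongs to \<open>T\<close>, the denominator of
      \<open>G T\<close> dominates that of \<open>?d\<close>.\<close>
    let ?d = "\<lambda>x. norm (g x) / (1 + (norm (h x))\<^sup>2)"
    have pos: "1 + (norm (h x))\<^sup>2 > 0" for x by (simp add: add_pos_nonneg)
    have "?d \<in> cfuns c"
      unfolding power2_eq_square using pos[unfolded power2_eq_square]
      by (intro cfuns_divide cfuns_intros g null_ideal_cfuns h(1)) (metis less_irrefl)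
    moreover have "eventually (\<lambda>T. \<forall>w. norm (G T w) \<le> ?d w) ?I"
    proof -
      have "eventually (\<lambda>T. {h} \<subseteq> T) ?I"
        using h(1) by (auto simp: eventually_finite_subsets_at_top intro!: exI[of _ "{h}"])
      with evT show ?thesis
      proof eventually_elim
        case (elim T)
        show ?case
        proof
          fix w
          have "(norm (h w))\<^sup>2 \<le> u T w"
            unfolding u_def using elim by (intro member_le_sum) auto
          moreover have "norm (G T w) = norm (g w) / (1 + u T w)"
            using u0[of T w] by (simp add: G_def norm_divide del: of_real_add)
          ultimately show "norm (G T w) \<le> ?d w"
            using pos[of w] by (simp add: frac_le)
        qed
      qed
    qed
    ultimately show "\<exists>d :: 'z \<Rightarrow> real. d \<in> cfuns c \<and> d z < e \<and>
        eventually (\<lambda>T. \<forall>w. norm (G T w) \<le> d w) ?I"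
      using h(2) by (intro exI[of _ ?d]) simp
  qed
  then have lim: "((\<lambda>T. \<mu> (G T)) \<longlongrightarrow> 0) ?I" by (rule functional_tendsto_zero)
  have "eventually (\<lambda>T. \<mu> (G T) = \<mu> g) ?I"
    using evT
  proof eventually_elim
    case (elim T)
    have "(\<lambda>z. \<Sum>h\<in>T. of_real ((norm (h z))\<^sup>2)) \<in> null_ideal"
      using elim by (intro null_ideal_sum null_ideal_norm_square) auto
    then have "(\<lambda>z. of_real (u T z)) \<in> null_ideal" by (simp add: u_def)
    then have "\<mu> (\<lambda>z. of_real (u T z) * G T z) = 0"
      using Gc elim by (intro null_idealD) auto
    moreover have "of_real (u T z) * G T z = g z - G T z" for z
      using nz[of T z] by (simp add: G_def field_simps)
    ultimately show ?case using functional_diff[OF g Gc] elim by simp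
  qed
  then have "((\<lambda>T. \<mu> (G T)) \<longlongrightarrow> \<mu> g) ?I" by (rule tendsto_eventually)
  with lim show ?thesis by (intro tendsto_unique[OF finite_subsets_at_top_neq_bot])
qed

section \<open>Bounds for a functional on its support\<close>

text \<open>Otherwise some \<open>g n\<close> of norm at most 1 have
  \<open>norm (\<mu> (g n)) > n\<close>. Then \<open>g n / n\<close> tends to 0 uniformly, hence
  continuously, yet its values under \<open>\<mu>\<close> stay above 1 in norm, against
  continuity.\<close>

lemma functional_bounded:
  obtains C where "C \<ge> 0" "\<And>g. g \<in> cfuns c \<Longrightarrow> (\<And>z. norm (g z) \<le> 1) \<Longrightarrow> norm (\<mu> g) \<le> C"
proof (rule ccontr)
  assume "\<not> thesis"
  then have "\<forall>n::nat. \<exists>g. g \<in> cfuns c \<and> (\<forall>z. norm (g z) \<le> 1) \<and> \<not> norm (\<mu> g) \<le> real n"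
    using that by (metis of_nat_0_le_iff)
  then obtain g where g: "\<And>n. g n \<in> cfuns c" "\<And>n z. norm (g n z) \<le> 1"
    "\<And>n::nat. \<not> norm (\<mu> (g n)) \<le> real n" by metis
  define G where "G n z = of_real (1 / real n) * g n z" for n z
  have "fun_conv c (filtermap G sequentially) (\<lambda>_. 0)"
  proof (rule fun_conv_zero_dominated)
    show "eventually (\<lambda>n. G n \<in> cfuns c) sequentially"
      unfolding G_def by (intro always_eventually allI cfuns_intros g)
  next
    fix z :: 'z and e :: real
    assume e: "e > 0"
    have "eventually (\<lambda>n. 1 / real n < e / 2) sequentially"
      using e by real_asymp
    then have "eventually (\<lambda>n. \<forall>w. norm (G n w) \<le> e / 2) sequentially"
    proof eventually_elim
      case (elim n)
      have "norm (G n w) \<le> 1 / real n * 1" for w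
        unfolding G_def norm_mult norm_of_real using g(2) by (intro mult_mono) auto
      with elim show ?case by (metis less_imp_le mult.right_neutral order_trans)
    qed
    then show "\<exists>d :: 'z \<Rightarrow> real. d \<in> cfuns c \<and> d z < e \<and>
        eventually (\<lambda>n. \<forall>w. norm (G n w) \<le> d w) sequentially"
      using e by (intro exI[of _ "\<lambda>_. e / 2"]) simp
  qed
  then have "((\<lambda>n. \<mu> (G n)) \<longlongrightarrow> 0) sequentially" by (rule functional_tendsto_zero)
  then have "eventually (\<lambda>n. norm (\<mu> (G n)) < 1) sequentially"
    by (simp add: tendsto_iff)
  moreover have "eventually (\<lambda>n::nat. n > 0) sequentially" by (rule eventually_gt_at_top)
  ultimately have "eventually (\<lambda>n::nat. False) sequentially"
  proof eventually_elim
    case (elim n)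
    have "norm (\<mu> (G n)) = norm (\<mu> (g n)) / real n"
      unfolding G_def using functional_scale[OF g(1)[of n], of "of_real (1 / real n)"]
      by (simp add: norm_mult norm_divide)
    then show False using elim g(3)[of n] by (simp add: divide_less_eq)
  qed
  then show False by simp
qed

text \<open>If functions \<open>g\<close> along \<open>\<Phi>\<close> exceeded \<open>e\<close> somewhere on the support, suitable
  multiples of \<open>max 0 (norm g - e)\<close> would still converge to 0 (they eventually vanish along
  every convergent filter) while their value under \<open>\<mu>\<close> is constantly 1.\<close>

lemma supp_uniform_convergence:
  assumes \<Phi>: "fun_conv c \<Phi> (\<lambda>_. 0 :: 'r)" and e: "e > 0"
  shows "eventually (\<lambda>g. \<forall>x\<in>supp. norm (g x) \<le> e) \<Phi>"
proof -
  define B :: "('z \<Rightarrow> 'r) set" where "B = {g \<in> cfuns c. \<not> (\<forall>x\<in>supp. norm (g x) \<le> e)}"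
  define h :: "('z \<Rightarrow> 'r) \<Rightarrow> 'z \<Rightarrow> 'r" where "h g z = of_real (max 0 (norm (g z) - e))" for g :: "'z \<Rightarrow> 'r" and z
  have "\<exists>k\<in>cfuns c. \<mu> (\<lambda>z. h g z * k z) = 1" if "g \<in> B" for g
  proof -
    from that obtain x where x: "x \<in> supp" "norm (g x) > e" and g: "g \<in> cfuns c"
      by (auto simp: B_def)
    have hc: "h g \<in> cfuns c" unfolding h_def by (intro cfuns_intros g)
    have "h g x \<noteq> 0" using x(2) by (simp add: h_def)
    with x(1) have "h g \<notin> null_ideal" by (auto simp: supp_def)
    with hc obtain k where k: "k \<in> cfuns c" "\<mu> (\<lambda>z. h g z * k z) \<noteq> 0"
      by (auto simp: null_ideal_def)
    let ?k = "\<lambda>z. k z * (1 / \<mu> (\<lambda>z. h g z * k z))"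
    have "\<mu> (\<lambda>z. h g z * ?k z) = 1"
      using functional_scale_right[OF cfuns_mult[OF hc k(1)], of "1 / \<mu> (\<lambda>z. h g z * k z)"] k(2)
      by (simp add: mult.assoc)
    moreover have "?k \<in> cfuns c" by (intro cfuns_intros k)
    ultimately show ?thesis by (intro bexI[of _ ?k])
  qed
  then obtain k where k: "\<And>g. g \<in> B \<Longrightarrow> k g \<in> cfuns c"
    "\<And>g. g \<in> B \<Longrightarrow> \<mu> (\<lambda>z. h g z * k g z) = 1" by metis
  \<comment> \<open>\<open>\<Phi>\<close> restricted to \<open>B\<close>. Properness is not claimed:
    the contradiction reached below along \<open>\<Psi>\<close> says exactly that
    \<open>\<Phi>\<close> eventually avoids \<open>B\<close>.\<close>
  define \<Psi> where "\<Psi> = inf \<Phi> (principal B)"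
  define G where "G g z = h g z * k g z" for g z
  have evB: "eventually (\<lambda>g. g \<in> B) \<Psi>" by (simp add: \<Psi>_def eventually_inf_principal)
  have "fun_conv c (filtermap G \<Psi>) (\<lambda>_. 0)"
  proof (rule fun_conv_zeroI)
    show "eventually (\<lambda>g. G g \<in> cfuns c) \<Psi>"
      using evB unfolding G_def h_def
      by eventually_elim (intro cfuns_intros k, auto simp: B_def)
  next
    fix F z and e' :: real
    assume c: "c F z" and e': "e' > 0"
    have "((\<lambda>(g, w). g w) \<longlongrightarrow> 0) (\<Phi> \<times>\<^sub>F F)" using \<Phi> c unfolding fun_conv_iff by blast
    then have "eventually (\<lambda>p. norm (fst p (snd p)) < e) (\<Phi> \<times>\<^sub>F F)"
      using e by (simp add: tendsto_iff case_prod_unfold)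
    moreover have "\<Psi> \<times>\<^sub>F F \<le> \<Phi> \<times>\<^sub>F F" by (intro prod_filter_mono) (simp_all add: \<Psi>_def)
    ultimately have "eventually (\<lambda>p. norm (fst p (snd p)) < e) (\<Psi> \<times>\<^sub>F F)"
      by (metis filter_leD)
    \<comment> \<open>Where \<open>norm (g w) < e\<close> the factor \<open>h g w\<close> is 0, so
      \<open>G g w\<close> vanishes however large \<open>k g w\<close> is.\<close>
    then show "eventually (\<lambda>(g, w). norm (G g w) < e') (\<Psi> \<times>\<^sub>F F)"
      by eventually_elim (use e' in \<open>simp add: G_def h_def case_prod_unfold\<close>)
  qed
  then have "((\<lambda>g. \<mu> (G g)) \<longlongrightarrow> 0) \<Psi>" by (rule functional_tendsto_zero)
  then have "eventually (\<lambda>g. norm (\<mu> (G g)) < 1) \<Psi>" by (simp add: tendsto_iff)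
  with evB have "eventually (\<lambda>g. False) \<Psi>"
  proof eventually_elim
    case (elim g)
    have "\<mu> (G g) = 1" using k(2)[OF elim(1)] unfolding G_def .
    with elim(2) show False by simp
  qed
  then have "eventually (\<lambda>g. g \<notin> B) \<Phi>" by (simp add: \<Psi>_def eventually_inf_principal)
  moreover have "eventually (\<lambda>g. g \<in> cfuns c) \<Phi>" using \<Phi> by (simp add: fun_conv_iff)
  ultimately show ?thesis by eventually_elim (auto simp: B_def)
qed

text \<open>A point is added to the support only to make the carrier nonempty.\<close>

lemma functional_carrier:
  assumes "conv_space c"
  obtains K C where "K \<noteq> {}" "C \<ge> 0"
    "\<And>g M. g \<in> cfuns c \<Longrightarrow> M > 0 \<Longrightarrow> (\<And>x. x \<in> K \<Longrightarrow> norm (g x) \<le> M) \<Longrightarrow> norm (\<mu> g) \<le> C * M"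
    "\<And>\<Phi> e. fun_conv c \<Phi> (\<lambda>_. 0 :: 'r) \<Longrightarrow> e > 0 \<Longrightarrow> eventually (\<lambda>g. \<forall>x\<in>K. norm (g x) \<le> e) \<Phi>"
proof -
  obtain C where C: "C \<ge> 0" "\<And>g. g \<in> cfuns c \<Longrightarrow> (\<And>z. norm (g z) \<le> 1) \<Longrightarrow> norm (\<mu> g) \<le> C"
    using functional_bounded by blast
  let ?K = "insert undefined supp"
  have "norm (\<mu> g) \<le> C * M"
    if g: "g \<in> cfuns c" and M: "M > 0" and le: "\<And>x. x \<in> ?K \<Longrightarrow> norm (g x) \<le> M" for g M
  proof -
    \<comment> \<open>Truncation: \<open>g'\<close> has norm at most 1 everywhere, and
      \<open>of_real M * g'\<close> agrees with \<open>g\<close> on the support, so both have the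
      same value under \<open>\<mu>\<close>.\<close>
    define g' where "g' z = g z / of_real (max M (norm (g z)))" for z
    have pos: "max M (norm (g z)) > 0" for z using M by simp
    have g': "g' \<in> cfuns c"
      unfolding g'_def using pos by (intro cfuns_divide cfuns_intros g) (metis of_real_eq_0_iff less_irrefl)
    have "norm (g' z) \<le> 1" for z
      using pos[of z] by (simp add: g'_def norm_divide divide_le_eq)
    with C(2)[OF g'] have "norm (\<mu> g') \<le> C" by blast
    moreover have "\<mu> (\<lambda>z. g z - of_real M * g' z) = 0"
    proof (rule functional_eq_zero)
      show "(\<lambda>z. g z - of_real M * g' z) \<in> cfuns c" by (intro cfuns_intros g g')
    next
      fix x assume "x \<in> supp"
      then have "max M (norm (g x)) = M" using le by (simp add: max_absorb1)
      then show "g x - of_real M * g' x = 0" using M by (simp add: g'_def)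
    qed
    then have "\<mu> g = of_real M * \<mu> g'"
      using functional_diff[OF g cfuns_mult[OF cfuns_const g']] functional_scale[OF g'] by simp
    ultimately show ?thesis using M by (simp add: norm_mult mult.commute)
  qed
  moreover have "eventually (\<lambda>g. \<forall>x\<in>?K. norm (g x) \<le> e) \<Phi>"
    if \<Phi>: "fun_conv c \<Phi> (\<lambda>_. 0 :: 'r)" and e: "e > 0" for \<Phi> e
  proof -
    \<comment> \<open>At the added point, testing continuous convergence against the principal
      filter gives pointwise convergence.\<close>
    have "c (principal {undefined}) undefined" using assms by (simp add: conv_space_def)
    then have "((\<lambda>(g, w). g w) \<longlongrightarrow> 0) (\<Phi> \<times>\<^sub>F principal {undefined})"
      using \<Phi> unfolding fun_conv_iff by blast
    then have "eventually (\<lambda>p. norm (fst p (snd p)) < e) (\<Phi> \<times>\<^sub>F principal {undefined})"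
      using e by (simp add: tendsto_iff case_prod_unfold)
    then have "eventually (\<lambda>g. norm (g undefined) < e) \<Phi>"
      by (simp add: prod_filter_principal_singleton2 eventually_filtermap)
    with supp_uniform_convergence[OF that] show ?thesis by eventually_elim auto
  qed
  ultimately show ?thesis using that[of ?K C] C(1) by blast
qed

end

section \<open>Products, sections and currying\<close>

text \<open>The projections of \<open>F \<times>\<^sub>F G\<close> are finer than \<open>F\<close>
  and \<open>G\<close>, possibly strictly if a factor is improper; isotony then finishes.\<close>

lemma prod_conv_prod_filter:
  assumes "conv_space cX" "conv_space cY" "cX F x" "cY G y"
  shows "prod_conv cX cY (F \<times>\<^sub>F G) (x, y)"
proof -
  have "filtermap fst (F \<times>\<^sub>F G) \<le> F" "filtermap snd (F \<times>\<^sub>F G) \<le> G"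
    using filterlim_fst filterlim_snd unfolding filterlim_def by blast+
  then show ?thesis using assms unfolding prod_conv_def conv_space_def by auto
qed

lemma prod_conv_swap:
  "prod_conv cX cY (filtermap prod.swap H) (prod.swap p) = prod_conv cY cX H p"
  by (auto simp: prod_conv_def filtermap_filtermap)

lemma cfuns_swap:
  assumes "f \<in> cfuns (prod_conv cX cY)"
  shows "(\<lambda>(y, x). f (x, y)) \<in> cfuns (prod_conv cY cX)"
  unfolding cfuns_iff
proof (intro allI impI)
  fix H p assume "prod_conv cY cX H p"
  then have "(f \<longlongrightarrow> f (prod.swap p)) (filtermap prod.swap H)"
    using assms prod_conv_swap[of cX cY H p] unfolding cfuns_iff by blast
  then show "((\<lambda>(y, x). f (x, y)) \<longlongrightarrow> (case p of (y, x) \<Rightarrow> f (x, y))) H"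
    by (simp add: filterlim_filtermap prod.swap_def case_prod_unfold)
qed

lemma cfuns_section:
  assumes "conv_space cX" "conv_space cY" "f \<in> cfuns (prod_conv cX cY)"
  shows "(\<lambda>x. f (x, y)) \<in> cfuns cX"
  unfolding cfuns_iff
proof (intro allI impI)
  fix F x assume "cX F x"
  moreover have "cY (principal {y}) y" using assms(2) by (simp add: conv_space_def)
  ultimately have "prod_conv cX cY (F \<times>\<^sub>F principal {y}) (x, y)"
    by (rule prod_conv_prod_filter[OF assms(1,2)])
  then have "(f \<longlongrightarrow> f (x, y)) (F \<times>\<^sub>F principal {y})"
    using assms(3) unfolding cfuns_iff by blast
  then show "((\<lambda>x. f (x, y)) \<longlongrightarrow> f (x, y)) F"
    by (simp add: prod_filter_principal_singleton2 filterlim_filtermap)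
qed

text \<open>One half of the exponential law, with function and parameter varying together. A fixed
  function yields continuity of the curried map; a varying one yields continuity of the iterated
  functional.\<close>

lemma fun_conv_curry:
  assumes X: "conv_space cX" and Y: "conv_space cY"
    and \<Phi>: "fun_conv (prod_conv cX cY) \<Phi> f" and G: "cY G y"
  shows "fun_conv cX (filtermap (\<lambda>(g, y) x. g (x, y)) (\<Phi> \<times>\<^sub>F G)) (\<lambda>x. f (x, y))"
  unfolding fun_conv_iff
proof (intro conjI allI impI)
  have "eventually (\<lambda>g. g \<in> cfuns (prod_conv cX cY)) \<Phi>" using \<Phi> by (simp add: fun_conv_iff)
  then have "eventually (\<lambda>p. fst p \<in> cfuns (prod_conv cX cY)) (\<Phi> \<times>\<^sub>F G)"
    unfolding eventually_prod_filter by (intro exI[of _ "\<lambda>_. True"] exI conjI) auto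
  then show "eventually (\<lambda>g. g \<in> cfuns cX) (filtermap (\<lambda>(g, y) x. g (x, y)) (\<Phi> \<times>\<^sub>F G))"
    unfolding eventually_filtermap
    by eventually_elim (auto simp: case_prod_unfold intro: cfuns_section[OF X Y])
  show "(\<lambda>x. f (x, y)) \<in> cfuns cX"
    using \<Phi> by (intro cfuns_section[OF X Y]) (simp add: fun_conv_iff)
next
  fix F x assume F: "cX F x"
  have 1: "((\<lambda>(g, w). g w) \<longlongrightarrow> f (x, y)) (\<Phi> \<times>\<^sub>F (F \<times>\<^sub>F G))"
    using \<Phi> prod_conv_prod_filter[OF X Y F G] by (auto simp: fun_conv_iff)
  \<comment> \<open>Regroups \<open>((g, y), x)\<close> as \<open>(g, (x, y))\<close>.\<close>
  have "filterlim (\<lambda>p. (fst (fst p), (snd p, snd (fst p)))) (\<Phi> \<times>\<^sub>F (F \<times>\<^sub>F G)) ((\<Phi> \<times>\<^sub>F G) \<times>\<^sub>F F)"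
    by (intro filterlim_Pair filterlim_snd filterlim_compose[OF filterlim_fst filterlim_fst]
        filterlim_compose[OF filterlim_snd filterlim_fst])
  from filterlim_compose[OF 1 this]
  show "((\<lambda>(g, w). g w) \<longlongrightarrow> f (x, y)) (filtermap (\<lambda>(g, y) x. g (x, y)) (\<Phi> \<times>\<^sub>F G) \<times>\<^sub>F F)"
    unfolding prod_filtermap1 filterlim_filtermap by (simp add: case_prod_unfold)
qed

lemma fun_conv_principal: "f \<in> cfuns c \<Longrightarrow> fun_conv c (principal {f}) f"
  unfolding fun_conv_iff
proof (intro conjI allI impI)
  fix F z assume "f \<in> cfuns c" "c F z"
  then have "(f \<longlongrightarrow> f z) F" by (simp add: cfuns_iff)
  then show "((\<lambda>(g, w). g w) \<longlongrightarrow> f z) (principal {f} \<times>\<^sub>F F)"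
    by (simp add: prod_filter_principal_singleton filterlim_filtermap)
qed (auto simp: eventually_principal)

lemma fun_conv_section:
  assumes X: "conv_space cX" and Y: "conv_space cY"
    and f: "f \<in> cfuns (prod_conv cX cY)" and G: "cY G y"
  shows "fun_conv cX (filtermap (\<lambda>y x. f (x, y)) G) (\<lambda>x. f (x, y))"
proof -
  have "filtermap (\<lambda>(g, y) x. g (x, y)) (principal {f} \<times>\<^sub>F G) = filtermap (\<lambda>y x. f (x, y)) G"
    by (simp add: prod_filter_principal_singleton filtermap_filtermap)
  with fun_conv_curry[OF X Y fun_conv_principal[OF f] G] show ?thesis by simp
qed

section \<open>Iterated functionals\<close>

text \<open>The curried form of \<open>f\<close> is continuous into the function space on which
  \<open>\<mu>\<close> is continuous.\<close>

lemma functional_section_continuous: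
  fixes f :: "'a \<times> 'b \<Rightarrow> 'r::real_normed_field"
  assumes X: "conv_space cX" and Y: "conv_space cY"
    and \<mu>: "cont_lin_functional cX \<mu>" and f: "f \<in> cfuns (prod_conv cX cY)"
  shows "(\<lambda>y. \<mu> (\<lambda>x. f (x, y))) \<in> cfuns cY"
  unfolding cfuns_iff
proof (intro allI impI)
  fix G y assume "cY G y"
  from functional_tendsto[OF \<mu> fun_conv_section[OF X Y f this]]
  show "((\<lambda>y. \<mu> (\<lambda>x. f (x, y))) \<longlongrightarrow> \<mu> (\<lambda>x. f (x, y))) G"
    by (simp add: filterlim_filtermap)
qed

text \<open>Applying \<open>\<mu>\<close> in \<open>x\<close> is a continuous map between function
  spaces: by \<open>fun_conv_curry\<close> its values converge jointly in the function and in
  \<open>y\<close>. Composing with \<open>\<nu>\<close> then gives continuity.\<close>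

lemma cont_lin_functional_iterated:
  fixes \<mu> :: "('a \<Rightarrow> 'r::real_normed_field) \<Rightarrow> 'r" and \<nu> :: "('b \<Rightarrow> 'r) \<Rightarrow> 'r"
  assumes X: "conv_space cX" and Y: "conv_space cY"
    and \<mu>: "cont_lin_functional cX \<mu>" and \<nu>: "cont_lin_functional cY \<nu>"
  shows "cont_lin_functional (prod_conv cX cY) (\<lambda>f. \<nu> (\<lambda>y. \<mu> (\<lambda>x. f (x, y))))"
proof -
  note sec = cfuns_section[OF X Y] functional_section_continuous[OF X Y \<mu>]
  have "top_conv (filtermap (\<lambda>f. \<nu> (\<lambda>y. \<mu> (\<lambda>x. f (x, y)))) \<Phi>) (\<nu> (\<lambda>y. \<mu> (\<lambda>x. f (x, y))))"
    if \<Phi>: "fun_conv (prod_conv cX cY) \<Phi> f" for \<Phi> f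
  proof -
    have "fun_conv cY (filtermap (\<lambda>g y. \<mu> (\<lambda>x. g (x, y))) \<Phi>) (\<lambda>y. \<mu> (\<lambda>x. f (x, y)))"
      unfolding fun_conv_iff
    proof (intro conjI allI impI)
      have "eventually (\<lambda>g. g \<in> cfuns (prod_conv cX cY)) \<Phi>" using \<Phi> by (simp add: fun_conv_iff)
      then show "eventually (\<lambda>g. g \<in> cfuns cY) (filtermap (\<lambda>g y. \<mu> (\<lambda>x. g (x, y))) \<Phi>)"
        unfolding eventually_filtermap by eventually_elim (rule sec)
      show "(\<lambda>y. \<mu> (\<lambda>x. f (x, y))) \<in> cfuns cY"
        using \<Phi> by (intro sec) (simp add: fun_conv_iff)
    next
      fix G y assume "cY G y"
      from functional_tendsto[OF \<mu> fun_conv_curry[OF X Y \<Phi> this]]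
      show "((\<lambda>(g, w). g w) \<longlongrightarrow> \<mu> (\<lambda>x. f (x, y)))
          (filtermap (\<lambda>g y. \<mu> (\<lambda>x. g (x, y))) \<Phi> \<times>\<^sub>F G)"
        unfolding prod_filtermap1 filterlim_filtermap by (simp add: case_prod_unfold)
    qed
    from functional_tendsto[OF \<nu> this] show ?thesis
      by (simp add: top_conv_def filterlim_def filtermap_filtermap)
  qed
  then show ?thesis
    unfolding cont_lin_functional_def
    by (auto simp: functional_add[OF \<mu>] functional_add[OF \<nu>] functional_scale[OF \<mu>]
        functional_scale[OF \<nu>] sec)
qed

section \<open>Uniform approximation by sums of tensors\<close>

text \<open>With \<open>d y s = (SUP x\<in>K. norm (f (x, y) - f (x, s)))\<close>, a Dini argument over the finite
  subsets of \<open>Y\<close> shows that \<open>L\<close> is totally bounded for the pseudometric \<open>d\<close>; a partition of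
  unity then gives the approximation.\<close>

lemma tensor_approximation:
  fixes f :: "'a \<times> 'b \<Rightarrow> 'r::real_normed_field"
  assumes X: "conv_space cX" and Y: "conv_space cY" and f: "f \<in> cfuns (prod_conv cX cY)"
    and K: "K \<noteq> {}"
      "\<And>\<Phi> e. fun_conv cX \<Phi> (\<lambda>_. 0 :: 'r) \<Longrightarrow> e > 0 \<Longrightarrow> eventually (\<lambda>g. \<forall>x\<in>K. norm (g x) \<le> e) \<Phi>"
    and L:
      "\<And>\<Phi> e. fun_conv cY \<Phi> (\<lambda>_. 0 :: 'r) \<Longrightarrow> e > 0 \<Longrightarrow> eventually (\<lambda>g. \<forall>y\<in>L. norm (g y) \<le> e) \<Phi>"
    and e: "e > 0"
  obtains S \<phi> where "finite (S :: 'b set)" "\<And>s. s \<in> S \<Longrightarrow> \<phi> s \<in> cfuns cY"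
    "\<And>x y. x \<in> K \<Longrightarrow> y \<in> L \<Longrightarrow> norm (f (x, y) - (\<Sum>s\<in>S. f (x, s) * \<phi> s y)) \<le> e"
proof -
  \<comment> \<open>Makes the suprema in \<open>d\<close> finite: the functions \<open>g / n\<close>
    converge continuously to 0, hence uniformly on \<open>K\<close>, so
    \<open>norm g \<le> n\<close> on \<open>K\<close> for some \<open>n\<close>.\<close>
  have bdd: "bdd_above ((\<lambda>x. norm (g x)) ` K)" if g: "g \<in> cfuns cX" for g :: "'a \<Rightarrow> 'r"
  proof -
    have "fun_conv cX (filtermap (\<lambda>(n::nat) x. of_real (1 / real n) * g x) sequentially) (\<lambda>_. 0)"
    proof (rule fun_conv_zeroI)
      fix F z and e :: real
      assume "cX F z" and e: "e > 0"
      then have "(g \<longlongrightarrow> g z) F" using g by (simp add: cfuns_iff)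
      then have lim: "((\<lambda>p. g (snd p)) \<longlongrightarrow> g z) (sequentially \<times>\<^sub>F F)"
        by (rule filterlim_compose[OF _ filterlim_snd])
      have "((\<lambda>n. 1 / real n) \<longlongrightarrow> 0) sequentially" by real_asymp
      then have "((\<lambda>n. of_real (1 / real n) :: 'r) \<longlongrightarrow> of_real 0) sequentially"
        by (rule tendsto_of_real)
      then have "((\<lambda>p. of_real (1 / real (fst p)) :: 'r) \<longlongrightarrow> of_real 0) (sequentially \<times>\<^sub>F F)"
        by (rule filterlim_compose[OF _ filterlim_fst])
      from tendsto_mult[OF this lim]
      show "eventually (\<lambda>(n, w). norm (of_real (1 / real n) * g w) < e) (sequentially \<times>\<^sub>F F)"
        using e by (simp add: tendsto_iff case_prod_unfold)
    qed (intro always_eventually allI cfuns_intros g)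
    from K(2)[OF this, of 1]
    have "eventually (\<lambda>n. \<forall>x\<in>K. norm (of_real (1 / real n) * g x) \<le> 1) sequentially"
      by (simp add: eventually_filtermap)
    moreover have "eventually (\<lambda>n::nat. n > 0) sequentially" by (rule eventually_gt_at_top)
    ultimately obtain n :: nat where n: "n > 0" "\<forall>x\<in>K. norm (of_real (1 / real n) * g x) \<le> 1"
      by (metis (mono_tags, lifting) eventually_conj eventually_happens' sequentially_bot)
    then have "norm (g x) \<le> real n" if "x \<in> K" for x
      using that by (auto simp: norm_mult norm_divide field_simps)
    then show ?thesis by (auto intro!: bdd_aboveI)
  qed
  define d where "d y s = (SUP x\<in>K. norm (f (x, y) - f (x, s)))" for y s
  note sec = cfuns_section[OF X Y f]
  have d_upper: "norm (f (x, y) - f (x, s)) \<le> d y s" if "x \<in> K" for x y s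
    unfolding d_def using that bdd[OF cfuns_diff[OF sec sec]] by (intro cSUP_upper)
  have d_least: "d y s \<le> M" if "\<And>x. x \<in> K \<Longrightarrow> norm (f (x, y) - f (x, s)) \<le> M" for y s M
    unfolding d_def using that K(1) by (intro cSUP_least)
  have d_self: "d s s = 0" for s using K(1) by (simp add: d_def)
  have d_nonneg: "d y s \<ge> 0" for y s
    using K(1) d_upper norm_ge_zero by (metis ex_in_conv order_trans)
  have d_triangle: "d y s \<le> d y y' + d y' s" for y y' s
  proof (rule d_least)
    fix x assume "x \<in> K"
    then show "norm (f (x, y) - f (x, s)) \<le> d y y' + d y' s"
      using norm_triangle_ineq[of "f (x, y) - f (x, y')" "f (x, y') - f (x, s)"]
        d_upper[of x y y'] d_upper[of x y' s] by simp
  qed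
  have d_sym: "d y s = d s y" for y s by (simp add: d_def norm_minus_commute)
  \<comment> \<open>The section at \<open>y'\<close> converges uniformly on \<open>K\<close> to that
    at \<open>y\<close>, so \<open>d y' y\<close> becomes small; the triangle inequality transfers
    this to \<open>d y' s\<close>.\<close>
  have dc: "(\<lambda>y. d y s) \<in> cfuns cY" for s
    unfolding cfuns_iff
  proof (intro allI impI tendstoI)
    fix G y and e :: real
    assume G: "cY G y" and e: "e > 0"
    from K(2)[OF fun_conv_diff[OF fun_conv_section[OF X Y f G]], of "e / 2"] e
    have "eventually (\<lambda>y'. \<forall>x\<in>K. norm (f (x, y') - f (x, y)) \<le> e / 2) G"
      by (simp add: eventually_filtermap)
    then show "eventually (\<lambda>y'. dist (d y' s) (d y s) < e) G"
    proof eventually_elim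
      case (elim y')
      then have "d y' y \<le> e / 2" by (intro d_least) auto
      then show ?case
        using d_triangle[of y' s y] d_triangle[of y s y'] d_sym[of y y'] e
        by (simp add: dist_real_def abs_if)
    qed
  qed
  \<comment> \<open>Covering radius, half the radius \<open>e\<close> of the bumps \<open>w\<close>
    below, so that a point within \<open>\<eta>\<close> of \<open>s\<close> gets weight at least
    \<open>\<eta>\<close> from \<open>s\<close>.\<close>
  define \<eta> where "\<eta> = e / 2"
  have \<eta>: "\<eta> > 0" using e by (simp add: \<eta>_def)
  \<comment> \<open>All factors lie between 0 and 1, and the factor of \<open>s\<close> vanishes at
    \<open>s\<close>. The product is 1 at points at distance at least \<open>\<eta>\<close> from all
    of \<open>S\<close>, so a bound below 1 on \<open>L\<close> makes \<open>S\<close> an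
    \<open>\<eta>\<close>-net for \<open>L\<close>.\<close>
  define u where "u S y = (\<Prod>s\<in>S. min 1 (d y s / \<eta>))" for S y
  let ?I = "finite_subsets_at_top (UNIV :: 'b set)"
  have factor: "0 \<le> min 1 (d y s / \<eta>)" "min 1 (d y s / \<eta>) \<le> 1" for y s
    using d_nonneg[of y s] \<eta> by auto
  have u0: "u S y \<ge> 0" for S y unfolding u_def using factor by (intro prod_nonneg) auto
  have uc: "u S \<in> cfuns cY" for S
    unfolding u_def using \<eta> by (intro cfuns_prod cfuns_min cfuns_const cfuns_divide dc) auto
  have "fun_conv cY (filtermap (\<lambda>S y. of_real (u S y)) ?I) (\<lambda>_. 0 :: 'r)"
  proof (rule fun_conv_zero_dominated)
    show "eventually (\<lambda>S. (\<lambda>y. of_real (u S y) :: 'r) \<in> cfuns cY) ?I"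
      by (intro always_eventually allI cfuns_of_real uc)
  next
    fix z and e :: real
    assume e: "e > 0"
    have "eventually (\<lambda>S. finite S \<and> {z} \<subseteq> S) ?I"
      unfolding eventually_finite_subsets_at_top by (intro exI[of _ "{z}"]) auto
    \<comment> \<open>The dominating function for \<open>z\<close> is the single factor of
      \<open>z\<close> without the cap at 1; it is continuous and vanishes at
      \<open>z\<close>.\<close>
    then have "eventually (\<lambda>S. \<forall>w. norm (of_real (u S w) :: 'r) \<le> d w z / \<eta>) ?I"
    proof eventually_elim
      case (elim S)
      have "u S w \<le> d w z / \<eta>" for w
      proof -
        have "u S w = min 1 (d w z / \<eta>) * u (S - {z}) w"
          unfolding u_def using elim by (subst prod.remove[of _ z]) auto
        also have "\<dots> \<le> min 1 (d w z / \<eta>) * 1"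
          using factor by (intro mult_left_mono) (auto simp: u_def intro!: prod_le_1)
        finally show ?thesis by simp
      qed
      then show ?case using u0 by simp
    qed
    moreover have "(\<lambda>w. d w z / \<eta>) \<in> cfuns cY" using \<eta> by (intro cfuns_divide dc cfuns_const) auto
    ultimately show "\<exists>d'. d' \<in> cfuns cY \<and> d' z < e \<and>
        eventually (\<lambda>S. \<forall>w. norm (of_real (u S w) :: 'r) \<le> d' w) ?I"
      using e by (intro exI[of _ "\<lambda>w. d w z / \<eta>"]) (simp add: d_self)
  qed
  from L[OF this, of "1/2"]
  have "eventually (\<lambda>S. \<forall>y\<in>L. u S y \<le> 1 / 2) ?I"
    using u0 by (simp add: eventually_filtermap)
  moreover have "eventually finite ?I" by (auto simp: eventually_finite_subsets_at_top)
  ultimately have "eventually (\<lambda>S. (\<forall>y\<in>L. u S y \<le> 1 / 2) \<and> finite S) ?I"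
    by (rule eventually_conj)
  from eventually_happens'[OF finite_subsets_at_top_neq_bot this]
  obtain S where S: "finite S" "\<And>y. y \<in> L \<Longrightarrow> u S y \<le> 1 / 2" by blast
  have cover: "\<exists>s\<in>S. d y s < \<eta>" if "y \<in> L" for y
  proof (rule ccontr)
    assume "\<not> (\<exists>s\<in>S. d y s < \<eta>)"
    then have "min 1 (d y s / \<eta>) = 1" if "s \<in> S" for s
      using that \<eta> by (auto simp: min_def field_simps)
    then have "u S y = 1" by (simp add: u_def)
    with S(2)[OF that] show False by simp
  qed
  define w where "w s y = max 0 (e - d y s)" for s y
  define W where "W y = (\<Sum>s\<in>S. w s y)" for y
  \<comment> \<open>The maximum with \<open>\<eta>\<close> keeps the denominator positive
    everywhere; on \<open>L\<close> it equals \<open>W\<close>, so the \<open>\<phi> s\<close> sum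
    to 1 there.\<close>
  define \<phi> where "\<phi> s y = w s y / max \<eta> (W y)" for s y
  have w0: "w s y \<ge> 0" for s y by (simp add: w_def)
  have wc: "w s \<in> cfuns cY" for s unfolding w_def by (intro cfuns_intros dc)
  have Wc: "W \<in> cfuns cY" unfolding W_def by (intro cfuns_intros wc)
  have \<phi>c: "\<phi> s \<in> cfuns cY" for s
    unfolding \<phi>_def using \<eta> by (intro cfuns_divide cfuns_intros wc Wc) auto
  have \<phi>0: "\<phi> s y \<ge> 0" for s y using w0[of s y] \<eta> by (simp add: \<phi>_def)
  have "norm (f (x, y) - (\<Sum>s\<in>S. f (x, s) * of_real (\<phi> s y))) \<le> e" if x: "x \<in> K" and y: "y \<in> L" for x y
  proof -
    obtain s where s: "s \<in> S" "d y s < \<eta>" using cover[OF y] by blast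
    have "\<eta> \<le> w s y" using s(2) by (simp add: w_def \<eta>_def max_def)
    also have "\<dots> \<le> W y" unfolding W_def using s(1) S(1) w0 by (intro member_le_sum) auto
    finally have W: "\<eta> \<le> W y" .
    have sum1: "(\<Sum>s\<in>S. \<phi> s y) = 1"
      using W \<eta> by (simp add: \<phi>_def max_absorb2 flip: sum_divide_distrib W_def)
    \<comment> \<open>As the weights sum to 1, the error is a convex combination of the differences
      \<open>f (x, y) - f (x, s)\<close>, and only those \<open>s\<close> with
      \<open>d y s < e\<close> carry weight.\<close>
    have "f (x, y) - (\<Sum>s\<in>S. f (x, s) * of_real (\<phi> s y))
        = f (x, y) * of_real (\<Sum>s\<in>S. \<phi> s y) - (\<Sum>s\<in>S. f (x, s) * of_real (\<phi> s y))"
      by (simp add: sum1)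
    also have "\<dots> = (\<Sum>s\<in>S. (f (x, y) - f (x, s)) * of_real (\<phi> s y))"
      by (simp add: sum_distrib_left left_diff_distrib sum_subtractf)
    also have "norm \<dots> \<le> (\<Sum>s\<in>S. \<phi> s y * e)"
    proof (rule sum_norm_le)
      fix s assume "s \<in> S"
      show "norm ((f (x, y) - f (x, s)) * of_real (\<phi> s y)) \<le> \<phi> s y * e"
      proof (cases "d y s < e")
        case True
        then have "norm (f (x, y) - f (x, s)) \<le> e" using d_upper[OF x, of y s] by simp
        then show ?thesis using \<phi>0[of s y]
          by (simp add: norm_mult mult.commute[of "\<phi> s y"] mult_right_mono)
      next
        case False
        then have "\<phi> s y = 0" by (simp add: \<phi>_def w_def)
        then show ?thesis by simp
      qed
    qed
    also have "\<dots> = e" using sum1 by (simp flip: sum_distrib_right)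
    finally show ?thesis .
  qed
  with S(1) that[of S "\<lambda>s y. of_real (\<phi> s y)"] \<phi>c show ?thesis
    by (simp add: cfuns_of_real)
qed

section \<open>Interchange of the two functionals and their tensor product\<close>

text \<open>On a sum of tensors both iterated functionals have the same value \<open>A\<close>.
  Approximating \<open>f\<close> on \<open>K \<times> L\<close> puts both sides within a multiple of
  \<open>e\<close> of \<open>A\<close>.\<close>

lemma iterated_functionals_commute:
  fixes \<mu> :: "('a \<Rightarrow> 'r::real_normed_field) \<Rightarrow> 'r" and \<nu> :: "('b \<Rightarrow> 'r) \<Rightarrow> 'r"
  assumes X: "conv_space cX" and Y: "conv_space cY"
    and \<mu>: "cont_lin_functional cX \<mu>" and \<nu>: "cont_lin_functional cY \<nu>"
    and f: "f \<in> cfuns (prod_conv cX cY)"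
  shows "\<nu> (\<lambda>y. \<mu> (\<lambda>x. f (x, y))) = \<mu> (\<lambda>x. \<nu> (\<lambda>y. f (x, y)))"
proof -
  obtain K C where K: "K \<noteq> {}" "C \<ge> 0"
    "\<And>g M. g \<in> cfuns cX \<Longrightarrow> M > 0 \<Longrightarrow> (\<And>x. x \<in> K \<Longrightarrow> norm (g x) \<le> M) \<Longrightarrow> norm (\<mu> g) \<le> C * M"
    "\<And>\<Phi> e. fun_conv cX \<Phi> (\<lambda>_. 0 :: 'r) \<Longrightarrow> e > 0 \<Longrightarrow> eventually (\<lambda>g. \<forall>x\<in>K. norm (g x) \<le> e) \<Phi>"
    using functional_carrier[OF \<mu> X] by blast
  obtain L D where L: "L \<noteq> {}" "D \<ge> 0"
    "\<And>g M. g \<in> cfuns cY \<Longrightarrow> M > 0 \<Longrightarrow> (\<And>y. y \<in> L \<Longrightarrow> norm (g y) \<le> M) \<Longrightarrow> norm (\<nu> g) \<le> D * M"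
    "\<And>\<Phi> e. fun_conv cY \<Phi> (\<lambda>_. 0 :: 'r) \<Longrightarrow> e > 0 \<Longrightarrow> eventually (\<lambda>g. \<forall>y\<in>L. norm (g y) \<le> e) \<Phi>"
    using functional_carrier[OF \<nu> Y] by blast
  note secX = cfuns_section[OF X Y f]
  have secY: "(\<lambda>y. f (x, y)) \<in> cfuns cY" for x
    using cfuns_section[OF Y X cfuns_swap[OF f], of x] by simp
  have fX: "(\<lambda>y. \<mu> (\<lambda>x. f (x, y))) \<in> cfuns cY"
    by (rule functional_section_continuous[OF X Y \<mu> f])
  have fY: "(\<lambda>x. \<nu> (\<lambda>y. f (x, y))) \<in> cfuns cX"
    using functional_section_continuous[OF Y X \<nu> cfuns_swap[OF f]] by simp
  \<comment> \<open>Large enough to absorb the two errors \<open>D * (C + 1)\<close> and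
    \<open>C * (D + 1)\<close>, and positive, so that \<open>e / B\<close> can be used at the
    end.\<close>
  define B where "B = 2 * (C + 1) * (D + 1)"
  have B: "B > 0" using K(2) L(2) by (simp add: B_def)
  have bound: "norm (\<nu> (\<lambda>y. \<mu> (\<lambda>x. f (x, y))) - \<mu> (\<lambda>x. \<nu> (\<lambda>y. f (x, y)))) \<le> B * e"
    if e: "e > 0" for e
  proof -
    obtain S \<phi> where S: "finite (S :: 'b set)" "\<And>s. s \<in> S \<Longrightarrow> \<phi> s \<in> cfuns cY"
      "\<And>x y. x \<in> K \<Longrightarrow> y \<in> L \<Longrightarrow> norm (f (x, y) - (\<Sum>s\<in>S. f (x, s) * \<phi> s y)) \<le> e"
      using tensor_approximation[OF X Y f K(1,4) L(4) e] by blast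
    define A where "A = (\<Sum>s\<in>S. \<mu> (\<lambda>x. f (x, s)) * \<nu> (\<phi> s))"
    let ?p = "\<lambda>y. \<Sum>s\<in>S. \<mu> (\<lambda>x. f (x, s)) * \<phi> s y"
    let ?q = "\<lambda>x. \<Sum>s\<in>S. f (x, s) * \<nu> (\<phi> s)"
    have p: "?p \<in> cfuns cY" by (intro cfuns_sum cfuns_mult cfuns_const S(2))
    have q: "?q \<in> cfuns cX" by (intro cfuns_sum cfuns_mult cfuns_const secX)
    \<comment> \<open>\<open>C + 1\<close> and \<open>D + 1\<close> replace \<open>C\<close> and
      \<open>D\<close> because the carrier estimates ask for a strictly positive bound.\<close>
    have C1: "(C + 1) * e > 0" "(D + 1) * e > 0" using K(2) L(2) e by simp_all
    have \<nu>p: "\<nu> ?p = A"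
      by (simp add: A_def functional_sum[OF \<nu>] functional_scale[OF \<nu>] cfuns_mult S(2))
    have \<mu>q: "\<mu> ?q = A"
      by (simp add: A_def functional_sum[OF \<mu>] functional_scale_right[OF \<mu>] cfuns_mult secX)
    \<comment> \<open>The inner functional is estimated over \<open>K\<close> for each fixed
      \<open>y\<close> in \<open>L\<close>, then the outer one over \<open>L\<close>.\<close>
    have "norm (\<nu> (\<lambda>y. \<mu> (\<lambda>x. f (x, y)) - ?p y)) \<le> D * ((C + 1) * e)"
    proof (rule L(3)[OF cfuns_diff[OF fX p] C1(1)])
      fix y assume y: "y \<in> L"
      have r: "(\<lambda>x. \<Sum>s\<in>S. f (x, s) * \<phi> s y) \<in> cfuns cX"
        by (intro cfuns_sum cfuns_mult cfuns_const secX)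
      have "?p y = \<mu> (\<lambda>x. \<Sum>s\<in>S. f (x, s) * \<phi> s y)"
        by (simp add: functional_sum[OF \<mu>] functional_scale_right[OF \<mu>] cfuns_mult secX)
      then have "\<mu> (\<lambda>x. f (x, y)) - ?p y = \<mu> (\<lambda>x. f (x, y) - (\<Sum>s\<in>S. f (x, s) * \<phi> s y))"
        using functional_diff[OF \<mu> secX r] by simp
      also have "norm \<dots> \<le> C * e" using S(3) y by (intro K(3) cfuns_diff secX r e)
      finally show "norm (\<mu> (\<lambda>x. f (x, y)) - ?p y) \<le> (C + 1) * e"
        using e by (simp add: algebra_simps)
    qed
    then have 1: "norm (\<nu> (\<lambda>y. \<mu> (\<lambda>x. f (x, y))) - A) \<le> D * ((C + 1) * e)"
      using functional_diff[OF \<nu> fX p] \<nu>p by simp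
    have "norm (\<mu> (\<lambda>x. \<nu> (\<lambda>y. f (x, y)) - ?q x)) \<le> C * ((D + 1) * e)"
    proof (rule K(3)[OF cfuns_diff[OF fY q] C1(2)])
      fix x assume x: "x \<in> K"
      have r: "(\<lambda>y. \<Sum>s\<in>S. f (x, s) * \<phi> s y) \<in> cfuns cY"
        by (intro cfuns_sum cfuns_mult cfuns_const S(2))
      have "?q x = \<nu> (\<lambda>y. \<Sum>s\<in>S. f (x, s) * \<phi> s y)"
        by (simp add: functional_sum[OF \<nu>] functional_scale[OF \<nu>] cfuns_mult S(2))
      then have "\<nu> (\<lambda>y. f (x, y)) - ?q x = \<nu> (\<lambda>y. f (x, y) - (\<Sum>s\<in>S. f (x, s) * \<phi> s y))"
        using functional_diff[OF \<nu> secY r] by simp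
      also have "norm \<dots> \<le> D * e" using S(3) x by (intro L(3) cfuns_diff secY r e)
      finally show "norm (\<nu> (\<lambda>y. f (x, y)) - ?q x) \<le> (D + 1) * e"
        using e by (simp add: algebra_simps)
    qed
    then have 2: "norm (\<mu> (\<lambda>x. \<nu> (\<lambda>y. f (x, y))) - A) \<le> C * ((D + 1) * e)"
      using functional_diff[OF \<mu> fY q] \<mu>q by simp
    have "D * ((C + 1) * e) + C * ((D + 1) * e) \<le> B * e"
      using K(2) L(2) e by (simp add: B_def algebra_simps)
    with 1 2 norm_triangle_ineq4[of "\<nu> (\<lambda>y. \<mu> (\<lambda>x. f (x, y))) - A" "\<mu> (\<lambda>x. \<nu> (\<lambda>y. f (x, y))) - A"]
    show ?thesis by simp
  qed
  have "norm (\<nu> (\<lambda>y. \<mu> (\<lambda>x. f (x, y))) - \<mu> (\<lambda>x. \<nu> (\<lambda>y. f (x, y)))) \<le> 0 + e" if "e > 0" for e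
    using bound[of "e / B"] that B by simp
  then have "norm (\<nu> (\<lambda>y. \<mu> (\<lambda>x. f (x, y))) - \<mu> (\<lambda>x. \<nu> (\<lambda>y. f (x, y)))) \<le> 0"
    by (rule field_le_epsilon)
  then show ?thesis by simp
qed

text \<open>Stated over \<open>real_normed_field\<close> so as to specialize to real and complex
  scalars alike. The iterated functional itself serves as \<open>\<rho>\<close>; uniqueness is
  immediate, since the identity prescribes the value at every continuous \<open>f\<close>.\<close>

lemma tensor_functional:
  fixes \<mu> :: "('a \<Rightarrow> 'r::real_normed_field) \<Rightarrow> 'r" and \<nu> :: "('b \<Rightarrow> 'r) \<Rightarrow> 'r"
  assumes X: "conv_space cX" and Y: "conv_space cY"
    and \<mu>: "cont_lin_functional cX \<mu>" and \<nu>: "cont_lin_functional cY \<nu>"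
  shows
   "(\<forall>f\<in>cfuns (prod_conv cX cY).
        conv_cont cY top_conv (\<lambda>y. \<mu> (\<lambda>x. f (x, y))) \<and>
        conv_cont cX top_conv (\<lambda>x. \<nu> (\<lambda>y. f (x, y)))) \<and>
    (\<exists>\<rho>. cont_lin_functional (prod_conv cX cY) \<rho> \<and>
        (\<forall>f\<in>cfuns (prod_conv cX cY).
            \<nu> (\<lambda>y. \<mu> (\<lambda>x. f (x, y))) = \<rho> f \<and> \<rho> f = \<mu> (\<lambda>x. \<nu> (\<lambda>y. f (x, y)))) \<and>
        (\<forall>\<rho>'. cont_lin_functional (prod_conv cX cY) \<rho>' \<and>
            (\<forall>f\<in>cfuns (prod_conv cX cY).
               \<nu> (\<lambda>y. \<mu> (\<lambda>x. f (x, y))) = \<rho>' f \<and> \<rho>' f = \<mu> (\<lambda>x. \<nu> (\<lambda>y. f (x, y))))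
            \<longrightarrow> (\<forall>f\<in>cfuns (prod_conv cX cY). \<rho>' f = \<rho> f)))"
proof (intro conjI ballI exI[of _ "\<lambda>f. \<nu> (\<lambda>y. \<mu> (\<lambda>x. f (x, y)))"] allI impI)
  fix f :: "'a \<times> 'b \<Rightarrow> 'r" assume f: "f \<in> cfuns (prod_conv cX cY)"
  show "conv_cont cY top_conv (\<lambda>y. \<mu> (\<lambda>x. f (x, y)))"
    using functional_section_continuous[OF X Y \<mu> f] by (simp add: cfuns_def)
  show "conv_cont cX top_conv (\<lambda>x. \<nu> (\<lambda>y. f (x, y)))"
    using functional_section_continuous[OF Y X \<nu> cfuns_swap[OF f]] by (simp add: cfuns_def)
  show "\<nu> (\<lambda>y. \<mu> (\<lambda>x. f (x, y))) = \<mu> (\<lambda>x. \<nu> (\<lambda>y. f (x, y)))"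
    by (rule iterated_functionals_commute[OF assms f])
qed (auto intro: cont_lin_functional_iterated[OF assms])

theorem theorem1p1:
  fixes cX :: "'a filter \<Rightarrow> 'a \<Rightarrow> bool" and cY :: "'b filter \<Rightarrow> 'b \<Rightarrow> bool"
  assumes "conv_space cX" and "conv_space cY"
  shows
   "(\<forall>(\<mu> :: ('a \<Rightarrow> real) \<Rightarrow> real) (\<nu> :: ('b \<Rightarrow> real) \<Rightarrow> real).
      cont_lin_functional cX \<mu> \<and> cont_lin_functional cY \<nu> \<longrightarrow>
      (\<forall>f\<in>cfuns (prod_conv cX cY).
          conv_cont cY top_conv (\<lambda>y. \<mu> (\<lambda>x. f (x, y))) \<and>
          conv_cont cX top_conv (\<lambda>x. \<nu> (\<lambda>y. f (x, y)))) \<and>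
      (\<exists>\<rho>. cont_lin_functional (prod_conv cX cY) \<rho> \<and>
          (\<forall>f\<in>cfuns (prod_conv cX cY).
              \<nu> (\<lambda>y. \<mu> (\<lambda>x. f (x, y))) = \<rho> f \<and> \<rho> f = \<mu> (\<lambda>x. \<nu> (\<lambda>y. f (x, y)))) \<and>
          (\<forall>\<rho>'. cont_lin_functional (prod_conv cX cY) \<rho>' \<and>
              (\<forall>f\<in>cfuns (prod_conv cX cY).
                 \<nu> (\<lambda>y. \<mu> (\<lambda>x. f (x, y))) = \<rho>' f \<and> \<rho>' f = \<mu> (\<lambda>x. \<nu> (\<lambda>y. f (x, y))))
              \<longrightarrow> (\<forall>f\<in>cfuns (prod_conv cX cY). \<rho>' f = \<rho> f)))) \<and>
    (\<forall>(\<mu> :: ('a \<Rightarrow> complex) \<Rightarrow> complex) (\<nu> :: ('b \<Rightarrow> complex) \<Rightarrow> complex).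
      cont_lin_functional cX \<mu> \<and> cont_lin_functional cY \<nu> \<longrightarrow>
      (\<forall>f\<in>cfuns (prod_conv cX cY).
          conv_cont cY top_conv (\<lambda>y. \<mu> (\<lambda>x. f (x, y))) \<and>
          conv_cont cX top_conv (\<lambda>x. \<nu> (\<lambda>y. f (x, y)))) \<and>
      (\<exists>\<rho>. cont_lin_functional (prod_conv cX cY) \<rho> \<and>
          (\<forall>f\<in>cfuns (prod_conv cX cY).
              \<nu> (\<lambda>y. \<mu> (\<lambda>x. f (x, y))) = \<rho> f \<and> \<rho> f = \<mu> (\<lambda>x. \<nu> (\<lambda>y. f (x, y)))) \<and>
          (\<forall>\<rho>'. cont_lin_functional (prod_conv cX cY) \<rho>' \<and>
              (\<forall>f\<in>cfuns (prod_conv cX cY).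
                 \<nu> (\<lambda>y. \<mu> (\<lambda>x. f (x, y))) = \<rho>' f \<and> \<rho>' f = \<mu> (\<lambda>x. \<nu> (\<lambda>y. f (x, y))))
              \<longrightarrow> (\<forall>f\<in>cfuns (prod_conv cX cY). \<rho>' f = \<rho> f))))"
  by (rule conjI; intro allI impI; elim conjE; rule tensor_functional[OF assms]; assumption)

end
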